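(* Consider the arrangement of lines $$\mathcal{A}'=\{x=m\}_{m\in1+3\mathbb{Z}}\cup\{y=n\}_{n\in1+3\mathbb{Z}}\cup\{x+y=k\}_{k\in2+3\mathbb{Z}},$$ which is the image of $\mathcal{A}_\triangle=\{x=m\}\cup\{y=n\}\cup\{x+y=k\}$, $m,n,k\in\mathbb{Z}$, under $(x,y)\mapsto(3x+1,3y+1)$. In suitable coordinates (a suitable affine chart of the dual projective plane, identified with the Euclidean plane) the projective dual of $\mathcal{A}'$ is exactly the following configuration $\mathcal{C}$: six half-lines from a common point (the vertex) at angular spacing $\pi/3$, carrying the points at distances $1/(3j-2)$, $j\ge1$, from the vertex on three alternate half-lines and the points at distances $1/(3j-1)$, $j\ge1$, on the other three half-lines. Consequently, the projective dual $S^*$ of the arrangement of lines $$\{y-x\in\mathbb{Z}\}\cup\{y-\tfrac x2\in\mathbb{Z}\}\cup\{2y-\tfrac32x\in\mathbb{Z}\}$$ is projectively equivalent to $\mathcal{C}$, which is a bounded realization of it.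
   Context: Projective duality takes the line $ax+by+c=0$ to the point $[a:b:c]$ of the dual projective plane; the projective dual of an arrangement is the set of points dual to its lines. Two subsets of real projective planes are projectively equivalent if a projective transformation takes one onto the other. *)

theory Defs
  imports "HOL-Analysis.Analysis"
begin

typedef proj_plane = "{span {v} | v :: real^3. v \<noteq> 0}"
proof -
  have "(axis 1 1 :: real^3) \<noteq> 0" by (simp add: axis_eq_0_iff)
  then show ?thesis by blast
qed

text \<open>\<open>homog [a, b, c]\<close> is the point with homogeneous coordinates \<open>[a : b : c]\<close>; its value at the
  zero vector is unspecified and never used.\<close>

definition homog :: "real^3 \<Rightarrow> proj_plane" where
  "homog v = Abs_proj_plane (span {v})"

lemma homog_eq_iff:
  assumes "v \<noteq> 0" "w \<noteq> 0"
  shows "homog v = homog w \<longleftrightarrow> (\<exists>c. c \<noteq> 0 \<and> w = c *\<^sub>R v)"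
proof -
  have "homog v = homog w \<longleftrightarrow> span {v} = span {w}"
    unfolding homog_def using assms by (subst Abs_proj_plane_inject) auto
  also have "\<dots> \<longleftrightarrow> (\<exists>c. c \<noteq> 0 \<and> w = c *\<^sub>R v)"
  proof
    assume "span {v} = span {w}"
    then have "w \<in> span {v}" by (simp add: span_base)
    then obtain c where "w = c *\<^sub>R v" by (auto simp: span_singleton)
    with assms show "\<exists>c. c \<noteq> 0 \<and> w = c *\<^sub>R v" by auto
  next
    assume "\<exists>c. c \<noteq> 0 \<and> w = c *\<^sub>R v"
    then obtain c where c: "c \<noteq> 0" "w = c *\<^sub>R v" by blast
    then have "v = (1 / c) *\<^sub>R w" by simp
    with c have "w \<in> span {v}" "v \<in> span {w}"
      by (metis span_base span_scale singletonI)+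
    then show "span {v} = span {w}"
      by (simp add: span_eq)
  qed
  finally show ?thesis .
qed

definition projective_transformation :: "(proj_plane \<Rightarrow> proj_plane) \<Rightarrow> bool" where
  "projective_transformation f \<longleftrightarrow>
     (\<exists>A :: real^3^3. invertible A \<and> (\<forall>v. v \<noteq> 0 \<longrightarrow> f (homog v) = homog (A *v v)))"

definition projectively_equivalent :: "proj_plane set \<Rightarrow> proj_plane set \<Rightarrow> bool" where
  "projectively_equivalent X Y \<longleftrightarrow> (\<exists>f. projective_transformation f \<and> f ` X = Y)"

definition std_embedding :: "real^2 \<Rightarrow> proj_plane" where
  "std_embedding p = homog (vector [p$1, p$2, 1])"

text \<open>An affine chart is given by its inverse, the embedding of the plane as the complement of a
  projective line.\<close>

definition affine_chart :: "(real^2 \<Rightarrow> proj_plane) \<Rightarrow> bool" where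
  "affine_chart \<phi> \<longleftrightarrow> (\<exists>f. projective_transformation f \<and> \<phi> = f \<circ> std_embedding)"

definition line_eq :: "real \<Rightarrow> real \<Rightarrow> real \<Rightarrow> (real^2) set" where
  "line_eq a b c = {p. a * p$1 + b * p$2 + c = 0}"

definition projective_dual :: "(real^2) set set \<Rightarrow> proj_plane set" where
  "projective_dual \<L> =
     {homog (vector [a, b, c]) | a b c. (a \<noteq> 0 \<or> b \<noteq> 0) \<and> line_eq a b c \<in> \<L>}"

definition A_triangle :: "(real^2) set set" where
  "A_triangle = {{p. p$1 = of_int m} | m :: int. True}
     \<union> {{p. p$2 = of_int n} | n :: int. True}
     \<union> {{p. p$1 + p$2 = of_int k} | k :: int. True}"

definition A_prime :: "(real^2) set set" where
  "A_prime = {{p. p$1 = of_int m} | m :: int. m \<in> {1 + 3 * i | i. True}}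
     \<union> {{p. p$2 = of_int n} | n :: int. n \<in> {1 + 3 * i | i. True}}
     \<union> {{p. p$1 + p$2 = of_int k} | k :: int. k \<in> {2 + 3 * i | i. True}}"

definition S_arr :: "(real^2) set set" where
  "S_arr = {{p. p$2 - p$1 = of_int n} | n :: int. True}
     \<union> {{p. p$2 - p$1 / 2 = of_int n} | n :: int. True}
     \<union> {{p. 2 * p$2 - 3 / 2 * p$1 = of_int n} | n :: int. True}"

definition half_line :: "real^2 \<Rightarrow> real \<Rightarrow> (real^2) set" where
  "half_line u \<alpha> = {u + t *\<^sub>R vector [cos \<alpha>, sin \<alpha>] | t. t \<ge> 0}"

text \<open>The configuration is determined up to congruence; \<open>u\<close> is its vertex and \<open>\<theta>\<close> the direction of
  one of the half-lines carrying the distances \<open>1/(3j - 2)\<close>. The vertex is not a point of the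
  configuration.\<close>

definition config :: "real^2 \<Rightarrow> real \<Rightarrow> (real^2) set" where
  "config u \<theta> =
     (\<Union>i\<in>{0, 2, 4 :: nat}. {p \<in> half_line u (\<theta> + real i * (pi / 3)).
        \<exists>j::nat. j \<ge> 1 \<and> dist u p = 1 / (3 * real j - 2)})
   \<union> (\<Union>i\<in>{1, 3, 5 :: nat}. {p \<in> half_line u (\<theta> + real i * (pi / 3)).
        \<exists>j::nat. j \<ge> 1 \<and> dist u p = 1 / (3 * real j - 1)})"

end

theory Submission
  imports Defs
begin

text \<open>A line of each of the three parallel families of \<open>A_prime\<close> or \<open>S_arr\<close> is dual to a point
  \<open>P + n R\<close>, \<open>Q + n R\<close> or \<open>P + Q + n R\<close> with \<open>n\<close> an integer, where \<open>P, Q, R\<close> is a basis of the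
  space of homogeneous coordinates. The configuration has the same shape: if \<open>d\<close> and \<open>e\<close> are two
  directions at angle \<open>2\<pi>/3\<close>, so that the third one is \<open>- d - e\<close>, take \<open>P = (u + d, 1)\<close>,
  \<open>Q = (u + e, 1)\<close> and \<open>R = 3 (u, 1)\<close>. Then \<open>P + n R\<close> represents \<open>u + d / (3 n + 1)\<close>, and
  \<open>P + Q + n R\<close> represents \<open>u + (d + e) / (3 n + 2)\<close>. Any two bases are related by an invertible
  matrix.\<close>

section \<open>Projective transformations\<close>

lemma homog_scaleR:
  assumes "c \<noteq> 0" "v \<noteq> 0"
  shows "homog (c *\<^sub>R v) = homog v"
  using assms by (subst homog_eq_iff) (auto intro: exI[of _ "1 / c"])

lemma homog_cases:
  obtains v where "v \<noteq> 0" "x = homog v"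
proof (cases x)
  case (Abs_proj_plane y)
  with that show ?thesis by (auto simp: homog_def)
qed

lemma matrix_vector_mult_nonzero:
  fixes A :: "real^'n^'n"
  assumes "invertible A" "v \<noteq> 0"
  shows "A *v v \<noteq> 0"
  using assms by (metis inj_matrix_vector_mult injD matrix_vector_mult_0_right)

text \<open>Nonzero representatives of a point differ by a nonzero factor, which \<open>A\<close>
  carries through, so the image point does not depend on the representative chosen.\<close>

lemma ex_projective_transformation:
  assumes "invertible A"
  obtains f where "projective_transformation f" "\<And>v. v \<noteq> 0 \<Longrightarrow> f (homog v) = homog (A *v v)"
proof -
  define f where "f x = homog (A *v (SOME v. v \<noteq> 0 \<and> x = homog v))" for x
  have *: "f (homog v) = homog (A *v v)" if v: "v \<noteq> 0" for v
  proof -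
    define w where "w = (SOME w. w \<noteq> 0 \<and> homog v = homog w)"
    have w: "w \<noteq> 0 \<and> homog v = homog w"
      unfolding w_def by (rule someI[of _ v]) (use that in auto)
    then obtain c where c: "c \<noteq> 0" "w = c *\<^sub>R v"
      using v homog_eq_iff[of v w] by blast
    have "f (homog v) = homog (A *v w)" by (simp add: f_def w_def)
    also have "A *v w = c *\<^sub>R (A *v v)"
      by (simp add: c matrix_vector_mult_scaleR)
    also have "homog \<dots> = homog (A *v v)"
      using c that assms by (simp add: homog_scaleR matrix_vector_mult_nonzero)
    finally show ?thesis .
  qed
  show thesis
    by (rule that[of f]) (use * assms in \<open>auto simp: projective_transformation_def\<close>)
qed

lemma projective_transformation_compose:
  assumes "projective_transformation f" "projective_transformation g"
  shows "projective_transformation (g \<circ> f)"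
proof -
  obtain A B where "invertible A" "\<And>v. v \<noteq> 0 \<Longrightarrow> f (homog v) = homog (A *v v)"
    and "invertible B" "\<And>v. v \<noteq> 0 \<Longrightarrow> g (homog v) = homog (B *v v)"
    using assms by (auto simp: projective_transformation_def)
  then show ?thesis
    unfolding projective_transformation_def
    by (intro exI[of _ "B ** A"])
      (auto simp: invertible_mult matrix_vector_mult_nonzero matrix_vector_mul_assoc)
qed

text \<open>The inverse matrix induces \<open>g\<close>. A left inverse is enough to make projective
  equivalence symmetric.\<close>

lemma projective_transformation_left_inverse:
  assumes "projective_transformation f"
  obtains g where "projective_transformation g" "g \<circ> f = id"
proof -
  obtain A where A: "invertible A" "\<And>v. v \<noteq> 0 \<Longrightarrow> f (homog v) = homog (A *v v)"
    using assms by (auto simp: projective_transformation_def)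
  then obtain B where B: "A ** B = mat 1" "B ** A = mat 1"
    by (auto simp: invertible_def)
  then have "invertible B" by (auto simp: invertible_def)
  then obtain g where g: "projective_transformation g" "\<And>v. v \<noteq> 0 \<Longrightarrow> g (homog v) = homog (B *v v)"
    by (rule ex_projective_transformation) blast
  have "g (f x) = x" for x
  proof (cases x rule: homog_cases)
    case (1 v)
    then show ?thesis
      using A(2)[of v] g(2)[of "A *v v"] matrix_vector_mult_nonzero[OF A(1), of v]
      by (simp add: matrix_vector_mul_assoc B(2))
  qed
  then have "g \<circ> f = id" by (simp add: fun_eq_iff)
  with g(1) show thesis by (rule that)
qed

lemma projectively_equivalent_sym:
  assumes "projectively_equivalent X Y"
  shows "projectively_equivalent Y X"
proof -
  obtain f where f: "projective_transformation f" "f ` X = Y"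
    using assms unfolding projectively_equivalent_def by blast
  obtain g where g: "projective_transformation g" "g \<circ> f = id"
    using f(1) by (rule projective_transformation_left_inverse)
  have "g ` Y = X"
    unfolding f(2)[symmetric] image_comp g(2) by simp
  with g(1) show ?thesis unfolding projectively_equivalent_def by blast
qed

lemma projectively_equivalent_trans:
  assumes "projectively_equivalent X Y" "projectively_equivalent Y Z"
  shows "projectively_equivalent X Z"
proof -
  obtain f g where f: "projective_transformation f" "f ` X = Y"
    and g: "projective_transformation g" "g ` Y = Z"
    using assms unfolding projectively_equivalent_def by blast
  have "(g \<circ> f) ` X = Z"
    unfolding image_comp[symmetric] f(2) g(2) ..
  then show ?thesis
    unfolding projectively_equivalent_def
    using projective_transformation_compose[OF f(1) g(1)] by blast
qed

section \<open>Triangular grids\<close>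

text \<open>The parameters are vectors, not points, because the set depends on their scaling. If
  they form a basis, its points lie on three lines through \<open>homog R\<close>, which is not
  itself in the set.\<close>

definition tri_grid :: "real^3 \<Rightarrow> real^3 \<Rightarrow> real^3 \<Rightarrow> proj_plane set" where
  "tri_grid P Q R = range (\<lambda>n::int. homog (P + of_int n *\<^sub>R R))
     \<union> range (\<lambda>n::int. homog (Q + of_int n *\<^sub>R R))
     \<union> range (\<lambda>n::int. homog (P + Q + of_int n *\<^sub>R R))"

abbreviation std_tri_grid :: "proj_plane set" where
  "std_tri_grid \<equiv> tri_grid (axis 1 1) (axis 2 1) (axis 3 1)"

lemma std_tri_grid_equivalent:
  assumes "det (vector [P, Q, R] :: real^3^3) \<noteq> 0"
  shows "projectively_equivalent std_tri_grid (tri_grid P Q R)"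
proof -
  \<comment> \<open>\<open>vector [P, Q, R]\<close> has these vectors as rows; transposing makes
    them columns, the images of the standard basis.\<close>
  define A where "A = transpose (vector [P, Q, R] :: real^3^3)"
  have "invertible A"
    using assms by (simp add: A_def invertible_det_nz)
  then obtain f where f: "projective_transformation f" "\<And>v. v \<noteq> 0 \<Longrightarrow> f (homog v) = homog (A *v v)"
    by (rule ex_projective_transformation) blast
  have A: "A *v axis 1 1 = P" "A *v axis 2 1 = Q" "A *v axis 3 1 = R"
    by (simp_all add: A_def matrix_vector_mult_basis column_transpose row_def vec_nth_inverse)
  \<comment> \<open>The formula for \<open>f\<close> is available at nonzero vectors only.\<close>
  have nz: "axis 1 1 + c *\<^sub>R axis 3 1 \<noteq> (0 :: real^3)" "axis 2 1 + c *\<^sub>R axis 3 1 \<noteq> (0 :: real^3)"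
    "axis 1 1 + axis 2 1 + c *\<^sub>R axis 3 1 \<noteq> (0 :: real^3)" for c
    by (auto simp: vec_eq_iff forall_3 axis_def)
  have "f ` std_tri_grid = tri_grid P Q R"
    by (simp add: tri_grid_def image_Un image_image f(2) nz A
        matrix_vector_right_distrib matrix_vector_mult_scaleR)
  with f(1) show ?thesis by (auto simp: projectively_equivalent_def)
qed

lemma tri_grid_equivalent:
  assumes "det (vector [P, Q, R] :: real^3^3) \<noteq> 0" "det (vector [P', Q', R'] :: real^3^3) \<noteq> 0"
  shows "projectively_equivalent (tri_grid P Q R) (tri_grid P' Q' R')"
  using projectively_equivalent_trans[OF projectively_equivalent_sym
      [OF std_tri_grid_equivalent[OF assms(1)]] std_tri_grid_equivalent[OF assms(2)]] .

section \<open>Duals of arrangements\<close>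

text \<open>\<open>projective_dual\<close> ranges over all equations of a line, so the dual point
  must not depend on the equation. Testing the second equation at two points of the line shows that
  it is a multiple of the first.\<close>

lemma line_eq_unique:
  assumes "a \<noteq> 0 \<or> b \<noteq> 0" "a' \<noteq> 0 \<or> b' \<noteq> 0" "line_eq a b c = line_eq a' b' c'"
  shows "homog (vector [a, b, c]) = homog (vector [a', b', c'])"
proof -
  have N: "a * a + b * b \<noteq> 0"
    using assms(1) by (simp add: sum_squares_eq_zero_iff)
  have mem: "a * x + b * y + c = 0 \<Longrightarrow> a' * x + b' * y + c' = 0" for x y
    using assms(3) by (auto simp: line_eq_def set_eq_iff dest: spec[of _ "vector [x, y] :: real^2"])
  \<comment> \<open>The foot of the perpendicular from the origin to the line.\<close>
  define x y where "x = - (c * a) / (a * a + b * b)" and "y = - (c * b) / (a * a + b * b)"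
  have xy: "a * x + b * y + c = 0"
    using assms(1) by (simp add: x_def y_def divide_simps) (auto simp: algebra_simps)
  have 1: "a' * x + b' * y + c' = 0"
    by (rule mem) fact
  \<comment> \<open>The vector \<open>(b, - a)\<close> is a direction of the line, so this is a
    second point on it; subtracting the two equations gives \<open>cross\<close>.\<close>
  have 2: "a' * (x + b) + b' * (y - a) + c' = 0"
    by (rule mem) (use xy in \<open>simp add: algebra_simps\<close>)
  have cross: "a' * b = b' * a"
    using 1 2 by (simp add: algebra_simps)
  \<comment> \<open>The coefficient of the orthogonal projection of \<open>(a', b')\<close> onto
    \<open>(a, b)\<close>; it avoids a case split on which of \<open>a\<close> and \<open>b\<close>
    is nonzero.\<close>
  define k where "k = (a * a' + b * b') / (a * a + b * b)"
  have "(a * a + b * b) * a' = (a * a' + b * b') * a" "(a * a + b * b) * b' = (a * a' + b * b') * b"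
    using cross by algebra+
  then have k: "a' = k * a" "b' = k * b"
    using N by (simp_all add: k_def field_simps)
  with assms(2) have "k \<noteq> 0" by auto
  moreover have "c' = k * c"
  proof -
    have "c' - k * c = (a' * x + b' * y + c') - k * (a * x + b * y + c)"
      by (simp add: k algebra_simps)
    then show ?thesis using 1 xy by simp
  qed
  ultimately have "vector [a', b', c'] = k *\<^sub>R (vector [a, b, c] :: real^3)"
    by (simp add: k vec_eq_iff forall_3)
  moreover have "vector [a, b, c] \<noteq> (0 :: real^3)"
    using assms(1) by (auto simp: vec_eq_iff forall_3)
  ultimately show ?thesis
    using \<open>k \<noteq> 0\<close> by (simp add: homog_scaleR)
qed

lemma projective_dual_Un: "projective_dual (X \<union> Y) = projective_dual X \<union> projective_dual Y"
  unfolding projective_dual_def by blast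

text \<open>Lets a dual be read off from one equation per line; by \<open>line_eq_unique\<close> the
  other equations add no points.\<close>

lemma projective_dual_range:
  assumes "\<And>n. a n \<noteq> 0 \<or> b n \<noteq> 0"
  shows "projective_dual (range (\<lambda>n. line_eq (a n) (b n) (c n)))
    = range (\<lambda>n. homog (vector [a n, b n, c n]))"
proof
  show "projective_dual (range (\<lambda>n. line_eq (a n) (b n) (c n)))
    \<subseteq> range (\<lambda>n. homog (vector [a n, b n, c n]))"
    unfolding projective_dual_def using line_eq_unique assms by blast
  show "range (\<lambda>n. homog (vector [a n, b n, c n]))
    \<subseteq> projective_dual (range (\<lambda>n. line_eq (a n) (b n) (c n)))"
    using assms by (auto simp: projective_dual_def)
qed

lemma A_prime_eq:
  "A_prime = range (\<lambda>n::int. line_eq 1 0 (- (1 + 3 * of_int n)))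
     \<union> range (\<lambda>n::int. line_eq 0 1 (- (1 + 3 * of_int n)))
     \<union> range (\<lambda>n::int. line_eq 1 1 (- (2 + 3 * of_int n)))"
proof -
  have *: "{F m | m :: int. m \<in> {k + 3 * i | i. True}} = range (\<lambda>n. F (k + 3 * n))"
    for F :: "int \<Rightarrow> (real^2) set" and k
    by auto
  show ?thesis
    unfolding A_prime_def *
    by (intro arg_cong2[where f = "(\<union>)"] image_cong) (auto simp: line_eq_def algebra_simps)
qed

lemma S_arr_eq:
  "S_arr = range (\<lambda>n::int. line_eq (-1) 1 (- of_int n))
     \<union> range (\<lambda>n::int. line_eq (-1/2) 1 (- of_int n))
     \<union> range (\<lambda>n::int. line_eq (-3/2) 2 (- of_int n))"
  unfolding S_arr_def full_SetCompr_eq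
  by (intro arg_cong2[where f = "(\<union>)"] arg_cong[where f = Collect] ext)
    (auto simp: line_eq_def image_iff algebra_simps)

text \<open>The residues fit: the offset 2 of the third family is the sum 1 + 1 of the other two
  offsets.\<close>

lemma projective_dual_A_prime:
  "projective_dual A_prime = tri_grid (vector [1, 0, -1]) (vector [0, 1, -1]) (vector [0, 0, -3])"
  unfolding A_prime_eq projective_dual_Un tri_grid_def
  by (subst projective_dual_range, simp)+
    (intro arg_cong2[where f = "(\<union>)"] image_cong arg_cong[where f = homog]; simp add: vec_eq_iff forall_3)

text \<open>The third family fits because (-3/2, 2) = (-1, 1) + (-1/2, 1).\<close>

lemma projective_dual_S_arr:
  "projective_dual S_arr = tri_grid (vector [-1, 1, 0]) (vector [-1/2, 1, 0]) (vector [0, 0, -1])"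
  unfolding S_arr_eq projective_dual_Un tri_grid_def
  by (subst projective_dual_range, simp)+
    (intro arg_cong2[where f = "(\<union>)"] image_cong arg_cong[where f = homog]; simp add: vec_eq_iff forall_3)

lemma image_A_triangle:
  "(\<lambda>L. (\<lambda>p :: real^2. vector [3 * p$1 + 1, 3 * p$2 + 1] :: real^2) ` L) ` A_triangle = A_prime"
proof -
  define h where "h = (\<lambda>p :: real^2. vector [3 * p$1 + 1, 3 * p$2 + 1] :: real^2)"
  define h' where "h' = (\<lambda>p :: real^2. vector [(p$1 - 1) / 3, (p$2 - 1) / 3] :: real^2)"
  have inv: "h' (h p) = p" "h (h' p) = p" for p
    by (simp_all add: h_def h'_def vec_eq_iff forall_2 field_simps)
  \<comment> \<open>Images under the bijection \<open>h\<close> become preimages under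
    \<open>h'\<close>, that is, substitutions into the equations of the lines.\<close>
  have im: "h ` L = {p. h' p \<in> L}" for L
  proof (intro set_eqI iffI)
    fix p assume "p \<in> {p. h' p \<in> L}"
    then show "p \<in> h ` L" using inv(2)[of p] by force
  qed (auto simp: inv)
  have tri: "A_triangle = range (\<lambda>n::int. line_eq 1 0 (- of_int n))
     \<union> range (\<lambda>n::int. line_eq 0 1 (- of_int n))
     \<union> range (\<lambda>n::int. line_eq 1 1 (- of_int n))"
    unfolding A_triangle_def full_SetCompr_eq
    by (intro arg_cong2[where f = "(\<union>)"] arg_cong[where f = Collect] ext)
      (auto simp: line_eq_def image_iff)
  have "(`) h ` A_triangle = A_prime"
    unfolding tri A_prime_eq image_Un image_image
    by (intro arg_cong2[where f = "(\<union>)"] image_cong)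
      (auto simp: im line_eq_def h'_def field_simps)
  then show ?thesis by (simp add: h_def)
qed

section \<open>The configuration of points on six half-lines\<close>

abbreviation dir :: "real \<Rightarrow> real^2" where
  "dir \<alpha> \<equiv> vector [cos \<alpha>, sin \<alpha>]"

lemma norm_dir: "norm (dir \<alpha>) = 1"
  by (simp add: norm_eq_sqrt_inner inner_vec_def sum_2 flip: power2_eq_square)

lemma dir_add_pi: "dir (\<alpha> + pi) = - dir \<alpha>"
  by (simp add: vec_eq_iff forall_2)

text \<open>These are the directions from the centre of an equilateral triangle to its vertices. The
  relation produces the sum \<open>P + Q\<close> of \<open>tri_grid\<close>.\<close>

lemma dir_third_sum: "dir \<alpha> + dir (\<alpha> + 2 * (pi / 3)) + dir (\<alpha> + 4 * (pi / 3)) = 0"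
proof -
  have "cos (4 * (pi / 3)) = - 1 / 2" "sin (4 * (pi / 3)) = - sqrt 3 / 2"
    using cos_periodic_pi[of "pi / 3"] sin_periodic_pi[of "pi / 3"]
    by (simp_all add: cos_60 sin_60)
  then show ?thesis
    by (simp add: vec_eq_iff forall_2 cos_add sin_add cos_120 sin_120 cos_120' sin_120')
qed

lemma half_line_dist:
  assumes "r \<ge> 0"
  shows "p \<in> half_line u \<alpha> \<and> dist u p = r \<longleftrightarrow> p = u + r *\<^sub>R dir \<alpha>"
  using assms by (auto simp: half_line_def dist_norm norm_dir)

lemma ray_points:
  assumes "\<And>j. j \<ge> 1 \<Longrightarrow> r j \<ge> 0"
  shows "{p \<in> half_line u \<alpha>. \<exists>j::nat. j \<ge> 1 \<and> dist u p = r j} = (\<lambda>j. u + r j *\<^sub>R dir \<alpha>) ` {1..}"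
  using assms half_line_dist[of "r _" _ u \<alpha>] by (auto simp: image_iff)

text \<open>The two distance sequences are the two signs of the single sequence 1/(3n + 1): n = j -
  1 gives 1/(3j - 2), and n = -j gives -1/(3j - 1). As j runs from 1, these n cover each integer
  once.\<close>

lemma opposite_rays:
  "(\<lambda>j::nat. u + (1 / (3 * real j - 2)) *\<^sub>R d) ` {1..}
     \<union> (\<lambda>j::nat. u + (1 / (3 * real j - 1)) *\<^sub>R (- d)) ` {1..}
   = range (\<lambda>n::int. u + (1 / (3 * of_int n + 1)) *\<^sub>R (d :: real^2))" (is "?A \<union> ?B = range ?f")
proof -
  have 1: "u + (1 / (3 * real j - 2)) *\<^sub>R d = ?f (int j - 1)" for j
    by (simp add: algebra_simps)
  have 2: "u + (1 / (3 * real j - 1)) *\<^sub>R (- d) = ?f (- int j)" for j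
  proof -
    have "1 / (3 * real_of_int (- int j) + 1) = - (1 / (3 * real j - 1))"
      unfolding minus_divide_right by simp
    then show ?thesis by (simp only: scaleR_minus_left scaleR_minus_right)
  qed
  have "n \<in> (\<lambda>j. int j - 1) ` {1..} \<union> (\<lambda>j. - int j) ` {1..}" for n
    by (cases "n \<ge> 0") (auto intro: image_eqI[of _ _ "nat (n + 1)"] image_eqI[of _ _ "nat (- n)"])
  then have "range ?f = ?f ` ((\<lambda>j. int j - 1) ` {1..} \<union> (\<lambda>j. - int j) ` {1..})"
    by blast
  then show ?thesis
    unfolding 1 2 image_Un image_image by simp
qed

lemma config_eq:
  "config u \<theta> = range (\<lambda>n::int. u + (1 / (3 * of_int n + 1)) *\<^sub>R dir \<theta>)
     \<union> range (\<lambda>n::int. u + (1 / (3 * of_int n + 1)) *\<^sub>R dir (\<theta> + 2 * (pi / 3)))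
     \<union> range (\<lambda>n::int. u + (1 / (3 * of_int n + 1)) *\<^sub>R dir (\<theta> + 4 * (pi / 3)))"
proof -
  \<comment> \<open>Each odd half-line is opposite to an even one: 1 to 4, 3 to 0, 5 to 2. The first
    pair matches only after a full turn.\<close>
  have angles: "\<theta> + 1 * (pi / 3) + 2 * pi = (\<theta> + 4 * (pi / 3)) + pi"
    "\<theta> + 3 * (pi / 3) = \<theta> + pi" "\<theta> + 5 * (pi / 3) = (\<theta> + 2 * (pi / 3)) + pi"
    by simp_all
  have opp: "dir (\<theta> + 1 * (pi / 3)) = - dir (\<theta> + 4 * (pi / 3))"
    "dir (\<theta> + 3 * (pi / 3)) = - dir \<theta>" "dir (\<theta> + 5 * (pi / 3)) = - dir (\<theta> + 2 * (pi / 3))"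
    unfolding dir_add_pi[symmetric] angles(2,3) angles(1)[symmetric] by (simp_all only: sin_periodic cos_periodic)
  have rays: "{p \<in> half_line u \<alpha>. \<exists>j::nat. j \<ge> 1 \<and> dist u p = 1 / (3 * real j - 2)}
      = (\<lambda>j::nat. u + (1 / (3 * real j - 2)) *\<^sub>R dir \<alpha>) ` {1..}"
    "{p \<in> half_line u \<alpha>. \<exists>j::nat. j \<ge> 1 \<and> dist u p = 1 / (3 * real j - 1)}
      = (\<lambda>j::nat. u + (1 / (3 * real j - 1)) *\<^sub>R dir \<alpha>) ` {1..}" for \<alpha>
    by (rule ray_points; simp)+
  have num: "real 0 * (pi / 3) = 0" "real 1 = 1" "real 2 = 2" "real 3 = 3" "real 4 = 4" "real 5 = 5"
    by simp_all
  show ?thesis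
    unfolding config_def rays opposite_rays[symmetric] UN_insert UN_empty num opp add_0_right
    by blast
qed

text \<open>Clearing the denominator makes the coordinates affine in \<open>c\<close>, so
  reciprocals of an arithmetic progression become an arithmetic progression of vectors.\<close>

lemma std_embedding_scaled:
  assumes "c \<noteq> 0"
  shows "std_embedding (u + (1 / c) *\<^sub>R d) = homog (vector [c * u$1 + d$1, c * u$2 + d$2, c])"
proof -
  have "vector [c * u$1 + d$1, c * u$2 + d$2, c]
    = c *\<^sub>R (vector [(u + (1 / c) *\<^sub>R d)$1, (u + (1 / c) *\<^sub>R d)$2, 1] :: real^3)"
    using assms by (simp add: vec_eq_iff forall_3 field_simps)
  moreover have "vector [a, b, 1] \<noteq> (0 :: real^3)" for a b :: real
    by (auto simp: vec_eq_iff forall_3)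
  ultimately show ?thesis
    using assms by (simp add: std_embedding_def homog_scaleR)
qed

lemma three_mult_add_nonzero:
  "3 * real_of_int n + 1 \<noteq> 0" "3 * real_of_int n + 2 \<noteq> 0"
proof -
  have "3 * n + 1 \<noteq> 0" "3 * n + 2 \<noteq> 0" by presburger+
  then have "real_of_int (3 * n + 1) \<noteq> 0" "real_of_int (3 * n + 2) \<noteq> 0"
    by (simp_all only: of_int_eq_0_iff not_False_eq_True)
  then show "3 * real_of_int n + 1 \<noteq> 0" "3 * real_of_int n + 2 \<noteq> 0" by simp_all
qed

lemma std_embedding_config:
  fixes u :: "real^2" and \<theta> :: real
  defines "d \<equiv> dir \<theta>" and "e \<equiv> dir (\<theta> + 2 * (pi / 3))"
  shows "std_embedding ` config u \<theta>
    = tri_grid (vector [u$1 + d$1, u$2 + d$2, 1]) (vector [u$1 + e$1, u$2 + e$2, 1])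
        (vector [3 * u$1, 3 * u$2, 3])"
proof -
  have third: "dir (\<theta> + 4 * (pi / 3)) = - (d + e)"
    using dir_third_sum[of \<theta>] unfolding d_def e_def by (metis add.commute eq_neg_iff_add_eq_0)
  define F where "F = (\<lambda>n::int. u + (1 / (3 * of_int n + 1)) *\<^sub>R (- (d + e)))"
  \<comment> \<open>Under n -> -1 - n the denominator 3n + 1 becomes -(3n + 2), whose sign cancels
    the one in \<open>- (d + e)\<close>.\<close>
  have F: "F (- 1 - n) = u + (1 / (3 * of_int n + 2)) *\<^sub>R (d + e)" for n
  proof -
    have "1 / (3 * real_of_int (- 1 - n) + 1) = - (1 / (3 * of_int n + 2))"
      unfolding minus_divide_right by simp
    then show ?thesis by (simp only: F_def scaleR_minus_left scaleR_minus_right minus_minus)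
  qed
  have "range F = range (\<lambda>n. F (- 1 - n))"
  proof -
    have "surj (\<lambda>n::int. - 1 - n)"
      by (rule surjI[of _ "\<lambda>n. - 1 - n"]) simp
    then show ?thesis by (metis image_image)
  qed
  then have cfg: "config u \<theta> = range (\<lambda>n::int. u + (1 / (3 * of_int n + 1)) *\<^sub>R d)
     \<union> range (\<lambda>n::int. u + (1 / (3 * of_int n + 1)) *\<^sub>R e)
     \<union> range (\<lambda>n::int. u + (1 / (3 * of_int n + 2)) *\<^sub>R (d + e))"
    unfolding config_eq third F F_def[symmetric] d_def[symmetric] e_def[symmetric] by simp
  show ?thesis
    unfolding cfg image_Un image_image tri_grid_def
      std_embedding_scaled[OF three_mult_add_nonzero(1)] std_embedding_scaled[OF three_mult_add_nonzero(2)]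
    by (intro arg_cong2[where f = "(\<union>)"] image_cong arg_cong[where f = homog])
      (simp_all add: vec_eq_iff forall_3 algebra_simps)
qed

lemma bounded_config: "bounded (config u \<theta>)"
proof (rule bounded_subset[OF bounded_cball])
  \<comment> \<open>The largest distance is 1, from 1/(3j - 2) at j = 1.\<close>
  show "config u \<theta> \<subseteq> cball u 1"
    by (auto simp: config_def)
qed

text \<open>Subtracting a third of the last row removes \<open>u\<close> from the other two, so the
  determinant for the configuration is 3 times the cross product of \<open>d\<close> and
  \<open>e\<close>, nonzero since they are not parallel.\<close>

lemma tri_grid_equivalent_config:
  assumes "det (vector [P, Q, R] :: real^3^3) \<noteq> 0"
  shows "projectively_equivalent (tri_grid P Q R) (std_embedding ` config u \<theta>)"
proof -
  define d e where "d = dir \<theta>" and "e = dir (\<theta> + 2 * (pi / 3))"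
  \<comment> \<open>The cross product of two unit vectors is the sine of the angle between
    them.\<close>
  have "d$1 * e$2 - d$2 * e$1 = sin (2 * (pi / 3))"
    using sin_diff[of "\<theta> + 2 * (pi / 3)" \<theta>] by (simp add: d_def e_def)
  also have "\<dots> = sqrt 3 / 2"
    using sin_120 by simp
  also have "\<dots> \<noteq> 0"
    by simp
  finally have "d$1 * e$2 - d$2 * e$1 \<noteq> 0" .
  moreover have "det (vector [vector [u$1 + d$1, u$2 + d$2, 1], vector [u$1 + e$1, u$2 + e$2, 1],
      vector [3 * u$1, 3 * u$2, 3]] :: real^3^3) = 3 * (d$1 * e$2 - d$2 * e$1)"
    by (simp add: det_3 algebra_simps)
  ultimately show ?thesis
    unfolding std_embedding_config d_def[symmetric] e_def[symmetric]
    by (intro tri_grid_equivalent assms) simp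
qed

theorem proposition8:
  fixes u :: "real^2" and \<theta> :: real
  shows "(\<lambda>L. (\<lambda>p :: real^2. vector [3 * p$1 + 1, 3 * p$2 + 1] :: real^2) ` L) ` A_triangle = A_prime
    \<and> (\<exists>\<phi>. affine_chart \<phi> \<and> projective_dual A_prime = \<phi> ` config u \<theta>)
    \<and> projectively_equivalent (projective_dual S_arr) (std_embedding ` config u \<theta>)
    \<and> bounded (config u \<theta>)"
proof (intro conjI)
  \<comment> \<open>The direction matters: a transformation from the configuration to the dual,
    composed with \<open>std_embedding\<close>, is the chart sought.\<close>
  have "projectively_equivalent (std_embedding ` config u \<theta>) (projective_dual A_prime)"
    unfolding projective_dual_A_prime
    by (rule projectively_equivalent_sym, rule tri_grid_equivalent_config) (simp add: det_3)
  then obtain f where f: "projective_transformation f"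
    and "f ` std_embedding ` config u \<theta> = projective_dual A_prime"
    unfolding projectively_equivalent_def by blast
  then have "projective_dual A_prime = (f \<circ> std_embedding) ` config u \<theta>"
    by (simp add: image_comp)
  with f show "\<exists>\<phi>. affine_chart \<phi> \<and> projective_dual A_prime = \<phi> ` config u \<theta>"
    unfolding affine_chart_def by blast
  show "projectively_equivalent (projective_dual S_arr) (std_embedding ` config u \<theta>)"
    unfolding projective_dual_S_arr
    by (rule tri_grid_equivalent_config) (simp add: det_3)
qed (rule image_A_triangle bounded_config)+

end
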